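(* Let $\mathcal A$ be a causal linear time-invariant algorithm with $n$ oracles and transfer function $\hat H(z)$, let $\kappa$ be a subset of its oracles with $D[\kappa]$ invertible, and let $\pi=(m+1,\dots,n,1,\dots,m)$ be a cyclic permutation of the oracles. Then conjugation and cyclic permutation commute: $\mathcal C_\kappa P_\pi\mathcal A$ and $P_\pi\mathcal C_\kappa\mathcal A$ have identical transfer functions.
   Context: A linear time-invariant algorithm with realization $(A,B,C,D)$ generates $x^{k+1}=Ax^k+Bu^k$, $y^k=Cx^k+Du^k$, $u^k=\phi(y^k)$, with oracles $\partial f_1,\dots,\partial f_n$ ((sub)gradients of convex functions) called sequentially in the order $1,\dots,n$; its transfer function is $\hat H(z)=C(zI-A)^{-1}B+D$. Causality means $D$ (blockwise by oracle, in call order) is lower triangular. $D[\kappa]$ is the principal block of $D$ indexed by $\kappa$. $P_\pi\mathcal A$ denotes the algorithm that executes the update equations of $\mathcal A$ in a different order so that the oracle calls within each iteration occur in the order $\pi$. $\mathcal C_\kappa\mathcal A$ denotes the algorithm obtained by rewriting $\mathcal A$ to call $\partial f_i^\star=(\partial f_i)^{-1}$ ($f^\star$ the Fenchel conjugate) instead of $\partial f_i$ for each $i\in\kappa$, thereby swapping oracle argument and output for those oracles. *)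

theory Defs
  imports Complex_Main "Jordan_Normal_Form.DL_Submatrix"
    "Jordan_Normal_Form.Gauss_Jordan_Elimination" "Jordan_Normal_Form.Determinant"
begin

text \<open>A linear time-invariant algorithm with n (scalar) oracles, labelled 0,...,n-1
  and called in this order within each iteration, is given by a real
  state-space realization (A,B,C,D): x(k+1) = A x(k) + B u(k), y(k) = C x(k) + D u(k).
  Vectors u, y are indexed by oracle label.\<close>

type_synonym lti = "real mat \<times> real mat \<times> real mat \<times> real mat"

definition lti_wf :: "nat \<Rightarrow> lti \<Rightarrow> bool" where
  "lti_wf n R = (case R of (A, B, C, D) \<Rightarrow>
     (\<exists>s. A \<in> carrier_mat s s \<and> B \<in> carrier_mat s n \<and> C \<in> carrier_mat n s \<and> D \<in> carrier_mat n n))"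

text \<open>Causality: D is lower triangular with respect to the call order 0,...,n-1.\<close>
definition causal :: "nat \<Rightarrow> lti \<Rightarrow> bool" where
  "causal n R = (case R of (A, B, C, D) \<Rightarrow>
     (\<forall>i<n. \<forall>j<n. i < j \<longrightarrow> D $$ (i, j) = 0))"

text \<open>Principal block D[kappa] of D.\<close>
definition Dblock :: "lti \<Rightarrow> nat set \<Rightarrow> real mat" where
  "Dblock R \<kappa> = (case R of (A, B, C, D) \<Rightarrow> submatrix D \<kappa> \<kappa>)"

text \<open>Diagonal 0/1 indicator matrix of a set of oracles.\<close>
definition ind_mat :: "nat \<Rightarrow> nat set \<Rightarrow> real mat" where
  "ind_mat n S = mat n n (\<lambda>(i, j). if i = j \<and> i \<in> S then 1 else 0)"

definition minv :: "'a :: field mat \<Rightarrow> 'a mat" where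
  "minv M = the (mat_inverse M)"

text \<open>Conjugation C_kappa: oracles in kappa are replaced by their inverses, i.e. for
  i in kappa the new input is y_i and the new output is u_i (other coordinates unchanged).
  With E the indicator of kappa and T = E D + (I - E) (invertible iff D[kappa] is),
  u = T^{-1} (u' - E C x), which yields the realization below.\<close>
definition conj_alg :: "nat \<Rightarrow> nat set \<Rightarrow> lti \<Rightarrow> lti" where
  "conj_alg n \<kappa> R = (case R of (A, B, C, D) \<Rightarrow>
     (let E = ind_mat n \<kappa>; I = 1\<^sub>m n; T = E * D + (I - E); Ti = minv T;
          M = E + (I - E) * D
      in (A - B * Ti * E * C, B * Ti, (I - E) * C - M * Ti * E * C, M * Ti)))"

text \<open>Cyclic permutation P_pi with pi = (m+1,...,n,1,...,m) (1-based), i.e. in 0-based labels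
  the oracles m,...,n-1 are called first, followed by 0,...,m-1 of the next original
  iteration: u'(k)_i = u(k)_i, y'(k)_i = y(k)_i for i >= m and u'(k)_i = u(k+1)_i,
  y'(k)_i = y(k+1)_i for i < m.  The state of the new algorithm is (x(k), F u(k)), where F
  is the indicator of {0,...,m-1}; causality (F D (I-F) = 0) is used.\<close>
definition perm_alg :: "nat \<Rightarrow> nat \<Rightarrow> lti \<Rightarrow> lti" where
  "perm_alg n m R = (case R of (A, B, C, D) \<Rightarrow>
     (let s = dim_row A; F = ind_mat n {..<m}; G = 1\<^sub>m n - F
      in (four_block_mat A (B * F) (0\<^sub>m n s) (0\<^sub>m n n),
          (B * G) @\<^sub>r F,
          four_block_mat (G * C + F * C * A) (G * D * F + F * C * B * F)
                         (0\<^sub>m 0 s) (0\<^sub>m 0 n),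
          G * D * G + F * C * B * G + F * D * F)))"

text \<open>Transfer function H(z) = C (zI - A)^{-1} B + D, defined where det(zI - A) \<noteq> 0.\<close>
definition res_ok :: "lti \<Rightarrow> complex \<Rightarrow> bool" where
  "res_ok R z = (case R of (A, B, C, D) \<Rightarrow>
     det (z \<cdot>\<^sub>m 1\<^sub>m (dim_row A) - map_mat complex_of_real A) \<noteq> 0)"

definition transfer :: "lti \<Rightarrow> complex \<Rightarrow> complex mat" where
  "transfer R z = (case R of (A, B, C, D) \<Rightarrow>
     map_mat complex_of_real C * minv (z \<cdot>\<^sub>m 1\<^sub>m (dim_row A) - map_mat complex_of_real A)
       * map_mat complex_of_real B + map_mat complex_of_real D)"

text \<open>Two algorithms have identical transfer functions (as rational matrix functions)
  iff the transfer matrices agree at every z where both are defined.\<close>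
definition same_transfer :: "lti \<Rightarrow> lti \<Rightarrow> bool" where
  "same_transfer R1 R2 = (\<forall>z. res_ok R1 z \<longrightarrow> res_ok R2 z \<longrightarrow> transfer R1 z = transfer R2 z)"

end

theory Submission
  imports Defs
begin

(* Both C_kappa P_pi A and P_pi C_kappa A run the oracles m..n-1 of one iteration of A followed by
   the oracles 0..m-1 of the next one, and both keep, besides the state x of A, the inputs of the
   oracles 0..m-1 already computed: the first algorithm stores original inputs F u, the second
   conjugated ones. Causality makes the latter a linear function of (x, F u), which gives a state
   map S with A2 S = S A1, B2 = S B1, C2 S = C1 and D2 = D1; such an intertwining forces equal
   transfer functions even though S need not be invertible. Invertibility of D[kappa] enters only
   through the diagonal of the lower triangular D: it makes the lower triangular systems defining
   both conjugations uniquely solvable. *)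

lemma mult_add_distrib_mat_vec_dim[simp]:
  "dim_col A = dim_vec v \<Longrightarrow> dim_vec w = dim_vec v \<Longrightarrow>
    (A :: 'a :: comm_ring mat) *\<^sub>v (v + w) = A *\<^sub>v v + A *\<^sub>v w"
  by (rule mult_add_distrib_mat_vec[of A "dim_row A" "dim_vec v"]) (auto intro!: carrier_matI carrier_vecI)

lemma mult_minus_distrib_mat_vec_dim[simp]:
  "dim_col A = dim_vec v \<Longrightarrow> dim_vec w = dim_vec v \<Longrightarrow>
    (A :: 'a :: comm_ring mat) *\<^sub>v (v - w) = A *\<^sub>v v - A *\<^sub>v w"
  by (rule mult_minus_distrib_mat_vec[of A "dim_row A" "dim_vec v"]) (auto intro!: carrier_matI carrier_vecI)

lemma add_mult_distrib_mat_vec_dim[simp]: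
  "dim_row A = dim_row B \<Longrightarrow> dim_col A = dim_col B \<Longrightarrow> dim_col A = dim_vec v \<Longrightarrow>
    ((A :: 'a :: comm_ring mat) + B) *\<^sub>v v = A *\<^sub>v v + B *\<^sub>v v"
  by (rule add_mult_distrib_mat_vec[of A "dim_row A" "dim_col A"]) (auto intro!: carrier_matI carrier_vecI)

lemma minus_mult_distrib_mat_vec_dim[simp]:
  "dim_row A = dim_row B \<Longrightarrow> dim_col A = dim_col B \<Longrightarrow> dim_col A = dim_vec v \<Longrightarrow>
    ((A :: 'a :: comm_ring mat) - B) *\<^sub>v v = A *\<^sub>v v - B *\<^sub>v v"
  by (rule minus_mult_distrib_mat_vec[of A "dim_row A" "dim_col A"]) (auto intro!: carrier_matI carrier_vecI)

lemma assoc_mult_mat_vec_dim[simp]: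
  "dim_col A = dim_row B \<Longrightarrow> dim_col B = dim_vec v \<Longrightarrow>
    ((A :: 'a :: comm_ring mat) * B) *\<^sub>v v = A *\<^sub>v (B *\<^sub>v v)"
  by (rule assoc_mult_mat_vec[of A "dim_row A" "dim_row B" B "dim_col B"]) (auto intro!: carrier_matI carrier_vecI)

lemma one_mult_mat_vec_dim[simp]: "dim_vec v = n \<Longrightarrow> 1\<^sub>m n *\<^sub>v (v :: 'a :: semiring_1 vec) = v"
  by (rule one_mult_mat_vec) auto

lemma zero_mult_mat_vec_dim[simp]: "dim_vec v = nc \<Longrightarrow> 0\<^sub>m nr nc *\<^sub>v (v :: 'a :: semiring_0 vec) = 0\<^sub>v nr"
  by (intro eq_vecI) (auto simp: scalar_prod_def)

lemma mult_mat_vec_zero_dim[simp]: "dim_col A = n \<Longrightarrow> A *\<^sub>v 0\<^sub>v n = (0\<^sub>v (dim_row A) :: 'a :: semiring_0 vec)"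
  by (intro eq_vecI) (auto simp: scalar_prod_def)

lemma add_zero_vec_dim[simp]: "dim_vec v = n \<Longrightarrow> v + 0\<^sub>v n = (v :: 'a :: monoid_add vec)"
  by auto

lemma zero_add_vec_dim[simp]: "dim_vec v = n \<Longrightarrow> 0\<^sub>v n + v = (v :: 'a :: monoid_add vec)"
  by auto

lemma smult_mult_mat_vec_dim[simp]:
  "dim_col A = dim_vec v \<Longrightarrow> (c \<cdot>\<^sub>m (A :: 'a :: comm_ring_1 mat)) *\<^sub>v v = c \<cdot>\<^sub>v (A *\<^sub>v v)"
  by (intro eq_vecI) (auto simp: scalar_prod_def sum_distrib_left ac_simps)

lemma mult_mat_vec_smult_dim[simp]:
  "dim_col A = dim_vec v \<Longrightarrow> (A :: 'a :: comm_ring_1 mat) *\<^sub>v (c \<cdot>\<^sub>v v) = c \<cdot>\<^sub>v (A *\<^sub>v v)"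
  by (intro eq_vecI) (auto simp: scalar_prod_def sum_distrib_left ac_simps)

lemma four_block_mat_mult_append_vec:
  assumes "A \<in> carrier_mat nr1 nc1" "B \<in> carrier_mat nr1 nc2" "C \<in> carrier_mat nr2 nc1"
    "D \<in> carrier_mat nr2 nc2" "dim_vec x = nc1" "dim_vec w = nc2"
  shows "four_block_mat A B C D *\<^sub>v (x @\<^sub>v w) = (A *\<^sub>v x + B *\<^sub>v w) @\<^sub>v (C *\<^sub>v x + D *\<^sub>v (w :: 'a :: comm_ring_1 vec))"
  using assms by (intro four_block_mat_mult_vec) auto

lemma append_rows_mult_vec:
  assumes "dim_col P = dim_vec a" "dim_col Q = dim_vec a"
  shows "(P @\<^sub>r Q) *\<^sub>v (a :: 'a :: comm_ring_1 vec) = (P *\<^sub>v a) @\<^sub>v (Q *\<^sub>v a)"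
proof -
  have "(P @\<^sub>r Q) *\<^sub>v (a @\<^sub>v 0\<^sub>v 0)
      = (P *\<^sub>v a + 0\<^sub>m (dim_row P) 0 *\<^sub>v 0\<^sub>v 0) @\<^sub>v (Q *\<^sub>v a + 0\<^sub>m (dim_row Q) 0 *\<^sub>v 0\<^sub>v 0)"
    unfolding append_rows_def using assms by (intro four_block_mat_mult_append_vec) auto
  moreover have "a @\<^sub>v 0\<^sub>v 0 = a" by (intro eq_vecI) auto
  ultimately show ?thesis using assms by simp
qed

lemma eq_mat_if_mult_vec_eq:
  assumes "A \<in> carrier_mat nr nc" "B \<in> carrier_mat nr nc"
    and "\<And>v. dim_vec v = nc \<Longrightarrow> A *\<^sub>v v = (B :: 'a :: semiring_1 mat) *\<^sub>v v"
  shows "A = B"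
proof (rule eq_matI)
  fix i j assume "i < dim_row B" "j < dim_col B"
  moreover have "(A *\<^sub>v unit_vec nc j) $ i = (B *\<^sub>v unit_vec nc j) $ i"
    using assms(3)[of "unit_vec nc j"] by simp
  ultimately show "A $$ (i, j) = B $$ (i, j)" using assms(1,2) by simp
qed (use assms in auto)

lemma minv_inverse:
  assumes T: "(T :: 'a :: field mat) \<in> carrier_mat n n" and "det T \<noteq> 0"
  shows "T * minv T = 1\<^sub>m n" "minv T * T = 1\<^sub>m n" "minv T \<in> carrier_mat n n"
proof -
  have "T \<in> Units (ring_mat TYPE('a) n ())" by (rule det_non_zero_imp_unit[OF T \<open>det T \<noteq> 0\<close>])
  then obtain B where "mat_inverse T = Some B"
    using mat_inverse(1)[OF T, of "()"] by (cases "mat_inverse T") auto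
  with mat_inverse(2)[OF T] show "T * minv T = 1\<^sub>m n" "minv T * T = 1\<^sub>m n" "minv T \<in> carrier_mat n n"
    by (auto simp: minv_def)
qed

lemma det_neq_0_if_mult_vec_inj:
  assumes T: "(T :: 'a :: idom mat) \<in> carrier_mat n n"
    and inj: "\<And>z. dim_vec z = n \<Longrightarrow> T *\<^sub>v z = 0\<^sub>v n \<Longrightarrow> z = 0\<^sub>v n"
  shows "det T \<noteq> 0"
  using det_0_iff_vec_prod_zero[OF T] inj by auto

(* From here on, entries of products A *v v are only unfolded on purpose; simp works with the
   dimension-driven rules above and the entry rules for indicator matrices below. *)
declare index_mult_mat_vec[simp del]

lemma dim_ind_mat[simp]: "dim_row (ind_mat n S) = n" "dim_col (ind_mat n S) = n"
  by (simp_all add: ind_mat_def)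

lemma index_ind_mat_mult_vec[simp]:
  assumes "i < n" "dim_vec v = n"
  shows "(ind_mat n S *\<^sub>v v) $ i = (if i \<in> S then v $ i else 0)"
proof -
  have "(ind_mat n S *\<^sub>v v) $ i = (\<Sum>j<n. (if i = j \<and> i \<in> S then 1 else 0) * v $ j)"
    using assms by (simp add: ind_mat_def scalar_prod_def lessThan_atLeast0 index_mult_mat_vec)
  also have "\<dots> = (\<Sum>j<n. if j = i then (if i \<in> S then v $ i else 0) else 0)"
    by (rule sum.cong) auto
  finally show ?thesis using assms(1) by simp
qed

lemma ind_mat_mult_vec_ind_mat[simp]:
  "dim_vec v = n \<Longrightarrow> ind_mat n S *\<^sub>v (ind_mat n S' *\<^sub>v v) = ind_mat n (S \<inter> S') *\<^sub>v v"
  by (intro eq_vecI) auto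

lemma index_ind_mat_mult:
  assumes "i < n" "j < dim_col M" "dim_row M = n"
  shows "(ind_mat n S * M) $$ (i, j) = (if i \<in> S then M $$ (i, j) else 0)"
proof -
  have "(ind_mat n S * M) $$ (i, j) = (ind_mat n S *\<^sub>v col M j) $ i"
    using assms by (simp add: index_mult_mat_vec)
  then show ?thesis using assms by simp
qed

definition lower_triangular_mat :: "'a :: zero mat \<Rightarrow> bool" where
  "lower_triangular_mat M \<longleftrightarrow> (\<forall>i j. i < j \<longrightarrow> j < dim_col M \<longrightarrow> M $$ (i, j) = 0)"

lemma lower_triangular_mult_vec_prefix:
  assumes M: "M \<in> carrier_mat n n" and low: "lower_triangular_mat M"
    and "i < m" "i < n" "dim_vec v = n"
  shows "(M *\<^sub>v v) $ i = (M *\<^sub>v (ind_mat n {..<m} *\<^sub>v v)) $ i"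
proof -
  have "M $$ (i, j) * v $ j = M $$ (i, j) * (ind_mat n {..<m} *\<^sub>v v) $ j" if "j < n" for j
    using that assms low unfolding lower_triangular_mat_def by (cases "j < m") auto
  then show ?thesis using assms by (auto simp: scalar_prod_def index_mult_mat_vec intro: sum.cong)
qed

lemma lower_triangular_mult_vec_eq_0:
  fixes M :: "'a :: idom mat"
  assumes M: "M \<in> carrier_mat n n" and low: "lower_triangular_mat M"
    and diag: "\<And>i. i \<in> P \<Longrightarrow> i < n \<Longrightarrow> M $$ (i, i) \<noteq> 0"
    and z: "dim_vec z = n" and supp: "\<And>j. j < n \<Longrightarrow> j \<notin> P \<Longrightarrow> z $ j = 0"
    and eqs: "\<And>i. i \<in> P \<Longrightarrow> i < n \<Longrightarrow> (M *\<^sub>v z) $ i = 0"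
  shows "z = 0\<^sub>v n"
proof -
  have "z $ i = 0" if "i < n" for i
    using that
  proof (induction i rule: less_induct)
    case (less i)
    show ?case
    proof (cases "i \<in> P")
      case True
      have off_diag: "M $$ (i, j) * z $ j = 0" if "j < n" "j \<noteq> i" for j
      proof (cases "j < i")
        case True
        then show ?thesis using less.IH that by simp
      next
        case False
        then show ?thesis using low M that unfolding lower_triangular_mat_def by auto
      qed
      have "(M *\<^sub>v z) $ i = (\<Sum>j = 0..<n. M $$ (i, j) * z $ j)"
        using M z less.prems by (simp add: index_mult_mat_vec scalar_prod_def)
      also have "\<dots> = (\<Sum>j = 0..<n. if j = i then M $$ (i, i) * z $ i else 0)"
        using off_diag by (intro sum.cong) auto
      also have "\<dots> = M $$ (i, i) * z $ i" using less.prems by simp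
      finally show ?thesis using eqs[OF True less.prems] diag[OF True less.prems] by simp
    qed (use supp less.prems in auto)
  qed
  with z show ?thesis by (intro eq_vecI) auto
qed

lemma lower_triangular_diag_neq_0_if_invertible_block:
  fixes D :: "'a :: field mat"
  assumes D: "D \<in> carrier_mat n n" and low: "lower_triangular_mat D"
    and \<kappa>: "\<kappa> \<subseteq> {..<n}" and inv: "invertible_mat (submatrix D \<kappa> \<kappa>)" and "k \<in> \<kappa>"
  shows "D $$ (k, k) \<noteq> 0"
proof -
  let ?K = "submatrix D \<kappa> \<kappa>" and ?c = "card \<kappa>"
  have fin: "finite \<kappa>" using \<kappa> finite_subset by blast
  have rows: "{i. i < dim_row D \<and> i \<in> \<kappa>} = \<kappa>" "{i. i < dim_col D \<and> i \<in> \<kappa>} = \<kappa>"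
    using \<kappa> D by auto
  have K: "?K \<in> carrier_mat ?c ?c" unfolding carrier_mat_def using rows by (simp add: dim_submatrix)
  have entry: "?K $$ (i, j) = D $$ (pick \<kappa> i, pick \<kappa> j)" if "i < ?c" "j < ?c" for i j
    using that rows by (simp add: submatrix_index)
  have "?K $$ (i, j) = 0" if "i < j" "j < ?c" for i j
  proof -
    have "pick \<kappa> i < pick \<kappa> j" "pick \<kappa> j \<in> \<kappa>"
      using pick_mono[of j \<kappa> i] pick_in_set[of j \<kappa>] that by auto
    then show ?thesis using entry[of i j] that low \<kappa> D unfolding lower_triangular_mat_def by auto
  qed
  then have det_K: "det ?K = (\<Prod>i = 0..<?c. ?K $$ (i, i))"
    using det_lower_triangular[OF _ K] K by (simp add: prod_list_diag_prod)
  from inv obtain B where KB: "?K * B = 1\<^sub>m ?c" and BK: "B * ?K = 1\<^sub>m (dim_row B)"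
    using K unfolding invertible_mat_def inverts_mat_def by auto
  have "B \<in> carrier_mat ?c ?c"
    using arg_cong[OF KB, of dim_col] arg_cong[OF BK, of dim_col] K by (auto intro: carrier_matI)
  then have "det ?K * det B = 1" using arg_cong[OF KB, of det] det_mult[OF K] by simp
  then have "det ?K \<noteq> 0" by auto
  then have "?K $$ (i, i) \<noteq> 0" if "i < ?c" for i using that det_K by simp
  moreover have "card {a \<in> \<kappa>. a < k} < ?c" using \<open>k \<in> \<kappa>\<close> by (intro psubset_card_mono[OF fin]) auto
  ultimately show ?thesis
    using entry[of "card {a \<in> \<kappa>. a < k}" "card {a \<in> \<kappa>. a < k}"] pick_card_in_set[OF \<open>k \<in> \<kappa>\<close>]
    by metis
qed

definition lti_dims :: "nat \<Rightarrow> nat \<Rightarrow> lti \<Rightarrow> bool" where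
  "lti_dims s n R \<longleftrightarrow> (case R of (A, B, C, D) \<Rightarrow>
     A \<in> carrier_mat s s \<and> B \<in> carrier_mat s n \<and> C \<in> carrier_mat n s \<and> D \<in> carrier_mat n n)"

definition lti_step :: "lti \<Rightarrow> real vec \<Rightarrow> real vec \<Rightarrow> real vec \<times> real vec" where
  "lti_step R x u = (case R of (A, B, C, D) \<Rightarrow> (A *\<^sub>v x + B *\<^sub>v u, C *\<^sub>v x + D *\<^sub>v u))"

lemma dim_lti_step:
  assumes "lti_dims s n R"
  shows "dim_vec (fst (lti_step R x u)) = s" "dim_vec (snd (lti_step R x u)) = n"
  using assms by (auto simp: lti_dims_def lti_step_def split: prod.splits)

lemma intertwining_if_simulation:
  assumes R1: "lti_dims N1 k (A1, B1, C1, D1)" and R2: "lti_dims N2 k (A2, B2, C2, D2)"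
    and S: "S \<in> carrier_mat N2 N1"
    and sim: "\<And>x u. dim_vec x = N1 \<Longrightarrow> dim_vec u = k \<Longrightarrow>
      lti_step (A2, B2, C2, D2) (S *\<^sub>v x) u = apfst ((*\<^sub>v) S) (lti_step (A1, B1, C1, D1) x u)"
  shows "A2 * S = S * A1" "B2 = S * B1" "C2 * S = C1" "D2 = D1"
proof -
  have dims[simp]: "dim_row A1 = N1" "dim_col A1 = N1" "dim_row B1 = N1" "dim_col B1 = k"
    "dim_row C1 = k" "dim_col C1 = N1" "dim_row D1 = k" "dim_col D1 = k"
    "dim_row A2 = N2" "dim_col A2 = N2" "dim_row B2 = N2" "dim_col B2 = k"
    "dim_row C2 = k" "dim_col C2 = N2" "dim_row D2 = k" "dim_col D2 = k"
    "dim_row S = N2" "dim_col S = N1"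
    using R1 R2 S by (auto simp: lti_dims_def)
  have state_eq: "A2 *\<^sub>v (S *\<^sub>v x) + B2 *\<^sub>v u = S *\<^sub>v (A1 *\<^sub>v x + B1 *\<^sub>v u)"
    and output_eq: "C2 *\<^sub>v (S *\<^sub>v x) + D2 *\<^sub>v u = C1 *\<^sub>v x + D1 *\<^sub>v u"
    if "dim_vec x = N1" "dim_vec u = k" for x u
    using sim[OF that] by (simp_all add: lti_step_def)
  show "A2 * S = S * A1"
    by (rule eq_mat_if_mult_vec_eq[of _ N2 N1]) (use state_eq[of _ "0\<^sub>v k"] in auto)
  show "B2 = S * B1"
    by (rule eq_mat_if_mult_vec_eq[of _ N2 k]) (use state_eq[of "0\<^sub>v N1"] in auto)
  show "C2 * S = C1"
    by (rule eq_mat_if_mult_vec_eq[of _ k N1]) (use output_eq[of _ "0\<^sub>v k"] in auto)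
  show "D2 = D1"
    by (rule eq_mat_if_mult_vec_eq[of _ k k]) (use output_eq[of "0\<^sub>v N1"] in auto)
qed

lemma minv_mult_vec_intertwining:
  fixes Z1 Z2 S :: "'a :: field mat"
  assumes Z1: "Z1 \<in> carrier_mat N1 N1" and Z2: "Z2 \<in> carrier_mat N2 N2" and S: "S \<in> carrier_mat N2 N1"
    and det1: "det Z1 \<noteq> 0" and det2: "det Z2 \<noteq> 0"
    and Z_S: "\<And>v. dim_vec v = N1 \<Longrightarrow> Z2 *\<^sub>v (S *\<^sub>v v) = S *\<^sub>v (Z1 *\<^sub>v v)"
    and y: "dim_vec y = N1"
  shows "minv Z2 *\<^sub>v (S *\<^sub>v y) = S *\<^sub>v (minv Z1 *\<^sub>v y)"
proof -
  note inv1 = minv_inverse[OF Z1 det1] and inv2 = minv_inverse[OF Z2 det2]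
  define v where "v = minv Z1 *\<^sub>v y"
  have v: "dim_vec v = N1" using y inv1(3) by (simp add: v_def)
  have "y = Z1 *\<^sub>v v" using inv1(1,3) Z1 y by (simp add: v_def flip: assoc_mult_mat_vec_dim)
  then have "minv Z2 *\<^sub>v (S *\<^sub>v y) = (minv Z2 * Z2) *\<^sub>v (S *\<^sub>v v)"
    using Z_S[OF v] v S Z2 inv2(3) by simp
  then show ?thesis using inv2(2) v S by (simp add: v_def)
qed

text \<open>\<open>C\<^sub>1 (z - A\<^sub>1)\<^sup>-\<^sup>1 B\<^sub>1 = C\<^sub>2 S (z - A\<^sub>1)\<^sup>-\<^sup>1 B\<^sub>1 =
  C\<^sub>2 (z - A\<^sub>2)\<^sup>-\<^sup>1 S B\<^sub>1 = C\<^sub>2 (z - A\<^sub>2)\<^sup>-\<^sup>1 B\<^sub>2\<close>\<close>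
lemma transfer_eq_if_intertwining:
  assumes R1: "lti_dims N1 k (A1, B1, C1, D1)" and R2: "lti_dims N2 k (A2, B2, C2, D2)"
    and S: "S \<in> carrier_mat N2 N1"
    and AS: "A2 * S = S * A1" and BS: "B2 = S * B1" and CS: "C2 * S = C1" and DS: "D2 = D1"
    and ok1: "res_ok (A1, B1, C1, D1) z" and ok2: "res_ok (A2, B2, C2, D2) z"
  shows "transfer (A1, B1, C1, D1) z = transfer (A2, B2, C2, D2) z"
proof -
  let ?h = "map_mat complex_of_real"
  have A1: "A1 \<in> carrier_mat N1 N1" and B1: "B1 \<in> carrier_mat N1 k" and C2: "C2 \<in> carrier_mat k N2"
    and A2: "A2 \<in> carrier_mat N2 N2"
    using R1 R2 by (auto simp: lti_dims_def)
  have dims[simp]: "dim_row A1 = N1" "dim_col A1 = N1" "dim_row B1 = N1" "dim_col B1 = k"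
    "dim_row C1 = k" "dim_col C1 = N1" "dim_row A2 = N2" "dim_col A2 = N2"
    "dim_row B2 = N2" "dim_col B2 = k" "dim_row C2 = k" "dim_col C2 = N2" "dim_row S = N2" "dim_col S = N1"
    using R1 R2 S by (auto simp: lti_dims_def)
  define Z1 where "Z1 = z \<cdot>\<^sub>m 1\<^sub>m N1 - ?h A1"
  define Z2 where "Z2 = z \<cdot>\<^sub>m 1\<^sub>m N2 - ?h A2"
  have Z1: "Z1 \<in> carrier_mat N1 N1" and Z2: "Z2 \<in> carrier_mat N2 N2" by (auto simp: Z1_def Z2_def)
  then have [simp]: "dim_row Z1 = N1" "dim_col Z1 = N1" "dim_row Z2 = N2" "dim_col Z2 = N2" by auto
  have det1: "det Z1 \<noteq> 0" and det2: "det Z2 \<noteq> 0"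
    using ok1 ok2 by (simp_all add: res_ok_def Z1_def Z2_def)
  have [simp]: "dim_row (minv Z1) = N1" "dim_col (minv Z1) = N1"
    "dim_row (minv Z2) = N2" "dim_col (minv Z2) = N2"
    using minv_inverse(3)[OF Z1 det1] minv_inverse(3)[OF Z2 det2] by auto
  have hAS: "?h A2 * ?h S = ?h S * ?h A1"
    using AS of_real_hom.mat_hom_mult[OF A2 S] of_real_hom.mat_hom_mult[OF S A1] by metis
  have Z_S: "Z2 *\<^sub>v (?h S *\<^sub>v v) = ?h S *\<^sub>v (Z1 *\<^sub>v v)" if "dim_vec v = N1" for v
  proof -
    have "?h A2 *\<^sub>v (?h S *\<^sub>v v) = ?h S *\<^sub>v (?h A1 *\<^sub>v v)"
      using arg_cong[OF hAS, of "\<lambda>M. M *\<^sub>v v"] that by simp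
    then show ?thesis using that by (simp add: Z1_def Z2_def)
  qed
  have "?h C1 * minv Z1 * ?h B1 = ?h C2 * minv Z2 * ?h B2"
  proof (rule eq_mat_if_mult_vec_eq[of _ k k])
    fix v :: "complex vec" assume "dim_vec v = k"
    moreover have "?h B2 = ?h S * ?h B1" "?h C1 = ?h C2 * ?h S"
      using of_real_hom.mat_hom_mult[OF S B1] of_real_hom.mat_hom_mult[OF C2 S] BS CS by auto
    ultimately show "(?h C1 * minv Z1 * ?h B1) *\<^sub>v v = (?h C2 * minv Z2 * ?h B2) *\<^sub>v v"
      using minv_mult_vec_intertwining[OF Z1 Z2 _ det1 det2 Z_S, of "?h B1 *\<^sub>v v"] S by simp
  qed auto
  then show ?thesis using DS by (simp add: transfer_def Z1_def Z2_def)
qed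

lemma same_transfer_if_simulation:
  assumes R1: "lti_dims N1 k R1" and R2: "lti_dims N2 k R2" and S: "S \<in> carrier_mat N2 N1"
    and sim: "\<And>x u. dim_vec x = N1 \<Longrightarrow> dim_vec u = k \<Longrightarrow>
      lti_step R2 (S *\<^sub>v x) u = apfst ((*\<^sub>v) S) (lti_step R1 x u)"
  shows "same_transfer R1 R2"
proof -
  obtain A1 B1 C1 D1 A2 B2 C2 D2 where "R1 = (A1, B1, C1, D1)" "R2 = (A2, B2, C2, D2)"
    by (cases R1, cases R2) auto
  with assms show ?thesis
    unfolding same_transfer_def
    using transfer_eq_if_intertwining intertwining_if_simulation by metis
qed

definition select_vec :: "nat \<Rightarrow> nat set \<Rightarrow> 'a vec \<Rightarrow> 'a vec \<Rightarrow> 'a vec" where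
  "select_vec n S v w = vec n (\<lambda>i. if i \<in> S then v $ i else w $ i)"

lemma dim_select_vec[simp]: "dim_vec (select_vec n S v w) = n"
  by (simp add: select_vec_def)

lemma index_select_vec[simp]: "i < n \<Longrightarrow> select_vec n S v w $ i = (if i \<in> S then v $ i else w $ i)"
  by (simp add: select_vec_def)

definition feedthrough :: "lti \<Rightarrow> real mat" where
  "feedthrough R = (case R of (A, B, C, D) \<Rightarrow> D)"

definition conj_input_mat :: "nat \<Rightarrow> nat set \<Rightarrow> real mat \<Rightarrow> real mat" where
  "conj_input_mat n \<kappa> D = ind_mat n \<kappa> * D + (1\<^sub>m n - ind_mat n \<kappa>)"

lemma dim_conj_input_mat[simp]: "dim_row (conj_input_mat n \<kappa> D) = n" "dim_col (conj_input_mat n \<kappa> D) = n"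
  by (simp_all add: conj_input_mat_def)

lemma conj_input_mat_carrier[simp]: "conj_input_mat n \<kappa> D \<in> carrier_mat n n"
  by (simp add: carrier_matI)

lemma index_conj_input_mat_mult_vec[simp]:
  assumes "i < n" "dim_vec v = n" "dim_row M = n" "dim_col M = n"
  shows "(conj_input_mat n \<kappa> M *\<^sub>v v) $ i = (if i \<in> \<kappa> then (M *\<^sub>v v) $ i else v $ i)"
  using assms by (simp add: conj_input_mat_def)

lemma select_vec_conj_input:
  assumes "C \<in> carrier_mat n s" "D \<in> carrier_mat n n" "dim_vec x = s" "dim_vec u = n"
  shows "select_vec n \<kappa> (C *\<^sub>v x + D *\<^sub>v u) u = conj_input_mat n \<kappa> D *\<^sub>v u + ind_mat n \<kappa> *\<^sub>v (C *\<^sub>v x)"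
  using assms by (intro eq_vecI) (auto simp: conj_input_mat_def)

lemma minv_conj_input_mat_inverse:
  assumes "lti_dims s n R" and "det (conj_input_mat n \<kappa> (feedthrough R)) \<noteq> 0"
  shows "conj_input_mat n \<kappa> (feedthrough R) * minv (conj_input_mat n \<kappa> (feedthrough R)) = 1\<^sub>m n"
    "minv (conj_input_mat n \<kappa> (feedthrough R)) * conj_input_mat n \<kappa> (feedthrough R) = 1\<^sub>m n"
    "minv (conj_input_mat n \<kappa> (feedthrough R)) \<in> carrier_mat n n"
  using assms minv_inverse[OF conj_input_mat_carrier]
  by (auto simp: lti_dims_def feedthrough_def split: prod.splits)

lemma lti_dims_conj_alg:
  assumes "lti_dims s n R" and "det (conj_input_mat n \<kappa> (feedthrough R)) \<noteq> 0"
  shows "lti_dims s n (conj_alg n \<kappa> R)"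
  using assms minv_conj_input_mat_inverse(3)[OF assms]
  by (cases R) (auto simp: lti_dims_def conj_alg_def conj_input_mat_def feedthrough_def Let_def)

lemma lti_step_conj_alg:
  assumes R: "lti_dims s n R" and T: "det (conj_input_mat n \<kappa> (feedthrough R)) \<noteq> 0"
    and x: "dim_vec x = s" and u: "dim_vec u = n" and step: "lti_step R x u = (x', y)"
    and a: "a = select_vec n \<kappa> y u"
  shows "lti_step (conj_alg n \<kappa> R) x a = (x', select_vec n \<kappa> u y)"
proof -
  obtain A B C D where R_eq: "R = (A, B, C, D)" by (cases R)
  let ?E = "ind_mat n \<kappa>" and ?T = "conj_input_mat n \<kappa> D"
  have A: "A \<in> carrier_mat s s" and B: "B \<in> carrier_mat s n" and C: "C \<in> carrier_mat n s"
    and D: "D \<in> carrier_mat n n"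
    using R by (auto simp: R_eq lti_dims_def)
  then have [simp]: "dim_row A = s" "dim_col A = s" "dim_row B = s" "dim_col B = n"
    "dim_row C = n" "dim_col C = s" "dim_row D = n" "dim_col D = n" by auto
  note inv = minv_conj_input_mat_inverse[OF R T, unfolded R_eq feedthrough_def, simplified]
  have [simp]: "dim_row (minv ?T) = n" "dim_col (minv ?T) = n" using inv(3) by auto
  have x'y: "x' = A *\<^sub>v x + B *\<^sub>v u" "y = C *\<^sub>v x + D *\<^sub>v u"
    using step by (auto simp: R_eq lti_step_def)
  have "a = ?T *\<^sub>v u + ?E *\<^sub>v (C *\<^sub>v x)" using select_vec_conj_input[OF C D x u] by (simp add: a x'y)
  then have "a - ?E *\<^sub>v (C *\<^sub>v x) = ?T *\<^sub>v u" using D u by (auto intro!: eq_vecI)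
  then have "minv ?T *\<^sub>v (a - ?E *\<^sub>v (C *\<^sub>v x)) = (minv ?T * ?T) *\<^sub>v u"
    using D u by (subst assoc_mult_mat_vec_dim) auto
  then have "minv ?T *\<^sub>v (a - ?E *\<^sub>v (C *\<^sub>v x)) = u" using inv(2) u by simp
  moreover have a_dim: "dim_vec a = n" using u by (simp add: a)
  ultimately have u_split: "minv ?T *\<^sub>v a = u + minv ?T *\<^sub>v (?E *\<^sub>v (C *\<^sub>v x))"
    using x u by (auto intro!: eq_vecI)
  have "conj_alg n \<kappa> R = (A - B * minv ?T * ?E * C, B * minv ?T,
      (1\<^sub>m n - ?E) * C - (?E + (1\<^sub>m n - ?E) * D) * minv ?T * ?E * C, (?E + (1\<^sub>m n - ?E) * D) * minv ?T)"
    by (simp add: R_eq conj_alg_def conj_input_mat_def Let_def)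
  then show ?thesis using x u a_dim by (auto simp: lti_step_def x'y u_split intro!: eq_vecI)
qed

lemma conj_alg_input_exists:
  assumes R: "lti_dims s n R" and T: "det (conj_input_mat n \<kappa> (feedthrough R)) \<noteq> 0"
    and x: "dim_vec x = s" and a: "dim_vec a = n"
  shows "\<exists>u. dim_vec u = n \<and> a = select_vec n \<kappa> (snd (lti_step R x u)) u"
proof -
  obtain A B C D where R_eq: "R = (A, B, C, D)" by (cases R)
  let ?E = "ind_mat n \<kappa>" and ?T = "conj_input_mat n \<kappa> D"
  have C: "C \<in> carrier_mat n s" and D: "D \<in> carrier_mat n n" using R by (auto simp: R_eq lti_dims_def)
  note inv = minv_conj_input_mat_inverse[OF R T, unfolded R_eq feedthrough_def, simplified]
  define u where "u = minv ?T *\<^sub>v (a - ?E *\<^sub>v (C *\<^sub>v x))"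
  have u: "dim_vec u = n" using inv(3) by (simp add: u_def)
  have "?T *\<^sub>v u = (?T * minv ?T) *\<^sub>v (a - ?E *\<^sub>v (C *\<^sub>v x))"
    unfolding u_def using inv(3) D C x a by (subst assoc_mult_mat_vec_dim) auto
  then have "?T *\<^sub>v u = a - ?E *\<^sub>v (C *\<^sub>v x)" using inv(1) C x a by simp
  then have "a = select_vec n \<kappa> (C *\<^sub>v x + D *\<^sub>v u) u"
    unfolding select_vec_conj_input[OF C D x u] using C x a by (auto intro!: eq_vecI)
  with u show ?thesis by (auto simp: R_eq lti_step_def)
qed

lemma lti_dims_perm_alg: "lti_dims s n R \<Longrightarrow> lti_dims (s + n) n (perm_alg n m R)"
  by (cases R) (auto simp: lti_dims_def perm_alg_def Let_def intro!: carrier_append_rows)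

lemma lti_step_perm_alg:
  fixes n m :: nat
  defines "F \<equiv> ind_mat n {..<m}"
  assumes R: "lti_dims s n R" and x: "dim_vec x = s" and w: "dim_vec w = n" and a: "dim_vec a = n"
    and step1: "lti_step R x (select_vec n {..<m} w a) = (x1, y1)"
    and step2: "snd (lti_step R x1 (F *\<^sub>v a)) = y2"
  shows "lti_step (perm_alg n m R) (x @\<^sub>v w) a = (x1 @\<^sub>v F *\<^sub>v a, select_vec n {..<m} y2 y1)"
proof -
  obtain A B C D where R_eq: "R = (A, B, C, D)" by (cases R)
  have A: "A \<in> carrier_mat s s" and B: "B \<in> carrier_mat s n" and C: "C \<in> carrier_mat n s"
    and D: "D \<in> carrier_mat n n"
    using R by (auto simp: R_eq lti_dims_def)
  then have [simp]: "dim_row A = s" "dim_col A = s" "dim_row B = s" "dim_col B = n"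
    "dim_row C = n" "dim_col C = s" "dim_row D = n" "dim_col D = n" by auto
  define G where "G = 1\<^sub>m n - F"
  have [simp]: "dim_row F = n" "dim_col F = n" "dim_row G = n" "dim_col G = n"
    by (simp_all add: F_def G_def)
  have select: "select_vec n {..<m} v v' = F *\<^sub>v v + G *\<^sub>v v'" if "dim_vec v = n" "dim_vec v' = n" for v v'
    using that by (auto simp: F_def G_def intro!: eq_vecI)
  have x1y1: "x1 = A *\<^sub>v x + B *\<^sub>v (F *\<^sub>v w + G *\<^sub>v a)" "y1 = C *\<^sub>v x + D *\<^sub>v (F *\<^sub>v w + G *\<^sub>v a)"
    and y2: "y2 = C *\<^sub>v x1 + D *\<^sub>v (F *\<^sub>v a)"
    using step1 step2 w a by (auto simp: R_eq lti_step_def select)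
  have F: "F \<in> carrier_mat n n" and G: "G \<in> carrier_mat n n"
    unfolding F_def G_def by (auto intro: carrier_matI)
  have "four_block_mat A (B * F) (0\<^sub>m n s) (0\<^sub>m n n) *\<^sub>v (x @\<^sub>v w)
      = (A *\<^sub>v x + (B * F) *\<^sub>v w) @\<^sub>v (0\<^sub>m n s *\<^sub>v x + 0\<^sub>m n n *\<^sub>v w)"
    using A B F x w by (intro four_block_mat_mult_append_vec) auto
  moreover have "((B * G) @\<^sub>r F) *\<^sub>v a = ((B * G) *\<^sub>v a) @\<^sub>v (F *\<^sub>v a)"
    using a by (intro append_rows_mult_vec) auto
  ultimately have "four_block_mat A (B * F) (0\<^sub>m n s) (0\<^sub>m n n) *\<^sub>v (x @\<^sub>v w) + ((B * G) @\<^sub>r F) *\<^sub>v a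
      = x1 @\<^sub>v F *\<^sub>v a"
    using x w a by (auto simp: x1y1 intro!: eq_vecI)
  moreover have "four_block_mat (G * C + F * C * A) (G * D * F + F * C * B * F) (0\<^sub>m 0 s) (0\<^sub>m 0 n)
      *\<^sub>v (x @\<^sub>v w) = ((G * C + F * C * A) *\<^sub>v x + (G * D * F + F * C * B * F) *\<^sub>v w)
        @\<^sub>v (0\<^sub>m 0 s *\<^sub>v x + 0\<^sub>m 0 n *\<^sub>v w)"
    using A B C D F G x w by (intro four_block_mat_mult_append_vec) auto
  then have "four_block_mat (G * C + F * C * A) (G * D * F + F * C * B * F) (0\<^sub>m 0 s) (0\<^sub>m 0 n)
      *\<^sub>v (x @\<^sub>v w) + (G * D * G + F * C * B * G + F * D * F) *\<^sub>v a = select_vec n {..<m} y2 y1"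
    using x w a by (auto simp: x1y1 y2 select intro!: eq_vecI)
  ultimately show ?thesis by (simp add: R_eq lti_step_def perm_alg_def Let_def F_def G_def)
qed

locale causal_lti =
  fixes n s m :: nat and \<kappa> :: "nat set" and A B C D :: "real mat"
  assumes dims: "lti_dims s n (A, B, C, D)"
    and causal: "lower_triangular_mat D"
    and diag: "\<And>i. i \<in> \<kappa> \<Longrightarrow> D $$ (i, i) \<noteq> 0"
    and m_le_n: "m \<le> n"
begin

abbreviation "E \<equiv> ind_mat n \<kappa>"
abbreviation "F \<equiv> ind_mat n {..<m}"
abbreviation "T \<equiv> conj_input_mat n \<kappa> D"

lemma carriers: "A \<in> carrier_mat s s" "B \<in> carrier_mat s n" "C \<in> carrier_mat n s" "D \<in> carrier_mat n n"
  using dims by (auto simp: lti_dims_def)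

lemma dim_mats[simp]: "dim_row A = s" "dim_col A = s" "dim_row B = s" "dim_col B = n"
  "dim_row C = n" "dim_col C = s" "dim_row D = n" "dim_col D = n"
  using carriers by auto

lemma index_T: "i < n \<Longrightarrow> j < n \<Longrightarrow> T $$ (i, j) = (if i \<in> \<kappa> then D $$ (i, j) else of_bool (i = j))"
  by (simp add: conj_input_mat_def index_ind_mat_mult del: index_mult_mat) (simp add: ind_mat_def)

lemma T_lower_triangular: "lower_triangular_mat T"
  using causal by (auto simp: lower_triangular_mat_def index_T)

lemma det_conj_input: "det (conj_input_mat n \<kappa> (feedthrough (A, B, C, D))) \<noteq> 0"
proof -
  have "det T = (\<Prod>i = 0..<n. T $$ (i, i))"
    using det_lower_triangular[of n T] T_lower_triangular
    by (simp add: lower_triangular_mat_def prod_list_diag_prod)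
  then show ?thesis using diag by (simp add: feedthrough_def index_T)
qed

lemma D_prefix: "i < m \<Longrightarrow> dim_vec v = n \<Longrightarrow> (D *\<^sub>v v) $ i = (D *\<^sub>v (F *\<^sub>v v)) $ i"
  by (rule lower_triangular_mult_vec_prefix[OF carriers(4) causal]) (use m_le_n in auto)

lemma T_prefix: "i < m \<Longrightarrow> dim_vec v = n \<Longrightarrow> (T *\<^sub>v v) $ i = (T *\<^sub>v (F *\<^sub>v v)) $ i"
  by (rule lower_triangular_mult_vec_prefix[OF conj_input_mat_carrier T_lower_triangular]) (use m_le_n in auto)

lemma F_mult_eq_if_T_mult_prefix_eq:
  assumes u: "dim_vec u = n" and u': "dim_vec u' = n"
    and eq: "\<And>i. i < m \<Longrightarrow> (T *\<^sub>v u) $ i = (T *\<^sub>v u') $ i"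
  shows "F *\<^sub>v u = F *\<^sub>v u'"
proof -
  have "F *\<^sub>v (u - u') = 0\<^sub>v n"
  proof (rule lower_triangular_mult_vec_eq_0[OF conj_input_mat_carrier T_lower_triangular])
    fix i assume i: "i \<in> {..<m}" "i < n"
    then have "(T *\<^sub>v (F *\<^sub>v (u - u'))) $ i = (T *\<^sub>v (u - u')) $ i"
      using u u' by (intro T_prefix[symmetric]) auto
    also have "\<dots> = (T *\<^sub>v u) $ i - (T *\<^sub>v u') $ i" using i u u' by simp
    finally show "(T *\<^sub>v (F *\<^sub>v (u - u'))) $ i = 0" using eq i by simp
  qed (use u u' diag in \<open>auto simp: index_T\<close>)
  then have "(F *\<^sub>v (u - u')) $ i = 0" if "i < n" for i using that by simp
  then show ?thesis using u u' by (auto intro!: eq_vecI)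
qed

abbreviation "G \<equiv> 1\<^sub>m n - F"

text \<open>In \<open>P\<^sub>\<pi> \<A>\<close> the oracles \<open>m..n-1\<close> are called first: solve for \<open>G z\<close>, then for \<open>F z\<close>.\<close>
lemma det_conj_input_perm_alg: "det (conj_input_mat n \<kappa> (feedthrough (perm_alg n m (A, B, C, D)))) \<noteq> 0"
proof -
  define Dp where "Dp = G * D * G + F * C * B * G + F * D * F"
  have [simp]: "dim_row Dp = n" "dim_col Dp = n" by (simp_all add: Dp_def)
  have "feedthrough (perm_alg n m (A, B, C, D)) = Dp" by (simp add: feedthrough_def perm_alg_def Let_def Dp_def)
  moreover have "z = 0\<^sub>v n" if z: "dim_vec z = n" and Tz: "conj_input_mat n \<kappa> Dp *\<^sub>v z = 0\<^sub>v n" for z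
  proof -
    have Tz_i: "(if i \<in> \<kappa> then (Dp *\<^sub>v z) $ i else z $ i) = 0" if "i < n" for i
      using z that arg_cong[OF Tz, of "\<lambda>v. v $ i"] by simp
    have Gz: "G *\<^sub>v z = 0\<^sub>v n"
    proof (rule lower_triangular_mult_vec_eq_0[OF conj_input_mat_carrier T_lower_triangular, of "{i. m \<le> i}"])
      fix i assume i: "i \<in> {i. m \<le> i}" "i < n"
      have "(Dp *\<^sub>v z) $ i = (D *\<^sub>v (G *\<^sub>v z)) $ i" using z i by (simp add: Dp_def)
      then show "(T *\<^sub>v (G *\<^sub>v z)) $ i = 0" using z i Tz_i[OF i(2)] by (auto split: if_splits)
    qed (use z diag in \<open>auto simp: index_T\<close>)
    have "F *\<^sub>v z = F *\<^sub>v 0\<^sub>v n"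
    proof (rule F_mult_eq_if_T_mult_prefix_eq[OF z])
      fix i assume i: "i < m"
      have "(Dp *\<^sub>v z) $ i = (D *\<^sub>v (F *\<^sub>v z)) $ i" using z i m_le_n Gz by (simp add: Dp_def)
      then show "(T *\<^sub>v z) $ i = (T *\<^sub>v 0\<^sub>v n) $ i"
        using z i m_le_n D_prefix[OF i z] Tz_i[of i] by (auto split: if_splits)
    qed simp
    then show ?thesis using Gz z by (auto intro!: eq_vecI dest!: fun_cong)
  qed
  ultimately show ?thesis by (intro det_neq_0_if_mult_vec_inj) auto
qed

lemma F_mult_conj_alg_output:
  assumes x: "dim_vec x = s" and u: "dim_vec u = n" and a: "dim_vec a = n"
    and a_prefix: "\<And>i. i < m \<Longrightarrow> a $ i = select_vec n \<kappa> (C *\<^sub>v x + D *\<^sub>v (F *\<^sub>v u)) u $ i"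
  shows "F *\<^sub>v snd (lti_step (conj_alg n \<kappa> (A, B, C, D)) x (F *\<^sub>v a))
    = F *\<^sub>v select_vec n \<kappa> u (C *\<^sub>v x + D *\<^sub>v (F *\<^sub>v u))"
proof -
  obtain u' where u': "dim_vec u' = n"
    and Fa: "F *\<^sub>v a = select_vec n \<kappa> (snd (lti_step (A, B, C, D) x u')) u'"
    using conj_alg_input_exists[OF dims det_conj_input x, of "F *\<^sub>v a"] a by auto
  define y where "y = C *\<^sub>v x + D *\<^sub>v u'"
  have step: "lti_step (A, B, C, D) x u' = (A *\<^sub>v x + B *\<^sub>v u', y)" by (simp add: lti_step_def y_def)
  have a_i: "a $ i = (if i \<in> \<kappa> then y $ i else u' $ i)" if "i < m" for i
    using a that m_le_n arg_cong[OF Fa, of "\<lambda>v. v $ i"] step by simp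
  have F_u': "F *\<^sub>v u' = F *\<^sub>v u"
  proof (rule F_mult_eq_if_T_mult_prefix_eq[OF u' u])
    fix i assume i: "i < m"
    then show "(T *\<^sub>v u') $ i = (T *\<^sub>v u) $ i"
      using m_le_n u u' x a_i[OF i] a_prefix[OF i] D_prefix[OF i u]
      by (auto simp: y_def split: if_splits)
  qed
  have "u' $ i = u $ i" if "i < m" for i
    using that m_le_n u u' arg_cong[OF F_u', of "\<lambda>v. v $ i"] by simp
  moreover have "(D *\<^sub>v u') $ i = (D *\<^sub>v (F *\<^sub>v u)) $ i" if "i < m" for i
    using D_prefix[OF that u'] F_u' by simp
  moreover have "snd (lti_step (conj_alg n \<kappa> (A, B, C, D)) x (F *\<^sub>v a)) = select_vec n \<kappa> u' y"
    using lti_step_conj_alg[OF dims det_conj_input x u' step] Fa step by simp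
  ultimately show ?thesis using x u u' by (auto simp: y_def intro!: eq_vecI)
qed

abbreviation "S \<equiv> four_block_mat (1\<^sub>m s) (0\<^sub>m s n) (F * E * C) (F * T * F)"

lemma S_carrier: "S \<in> carrier_mat (s + n) (s + n)"
  by (intro four_block_carrier_mat) (auto intro: carrier_matI)

lemma S_mult_vec:
  assumes x: "dim_vec x = s" and w: "dim_vec w = n"
  shows "S *\<^sub>v (x @\<^sub>v w) = x @\<^sub>v F *\<^sub>v select_vec n \<kappa> (C *\<^sub>v x + D *\<^sub>v (F *\<^sub>v w)) (F *\<^sub>v w)"
proof -
  have "S *\<^sub>v (x @\<^sub>v w) = (1\<^sub>m s *\<^sub>v x + 0\<^sub>m s n *\<^sub>v w) @\<^sub>v ((F * E * C) *\<^sub>v x + (F * T * F) *\<^sub>v w)"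
    using x w by (intro four_block_mat_mult_append_vec) (auto intro: carrier_matI)
  then show ?thesis using x w by (auto intro!: eq_vecI)
qed

lemma conj_perm_simulation:
  assumes v: "dim_vec v = s + n" and a: "dim_vec a = n"
  shows "lti_step (perm_alg n m (conj_alg n \<kappa> (A, B, C, D))) (S *\<^sub>v v) a
    = apfst ((*\<^sub>v) S) (lti_step (conj_alg n \<kappa> (perm_alg n m (A, B, C, D))) v a)"
proof -
  define x w where "x = vec_first v s" and "w = vec_last v n"
  have x: "dim_vec x = s" and w: "dim_vec w = n" by (simp_all add: x_def w_def)
  have "v = x @\<^sub>v w" unfolding x_def w_def using v by (intro vec_first_last_append[symmetric] carrier_vecI)
  have Rp: "lti_dims (s + n) n (perm_alg n m (A, B, C, D))" by (rule lti_dims_perm_alg[OF dims])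
  have Rc: "lti_dims s n (conj_alg n \<kappa> (A, B, C, D))" by (rule lti_dims_conj_alg[OF dims det_conj_input])
  have xw: "dim_vec (x @\<^sub>v w) = s + n" using x w by simp
  obtain u where u: "dim_vec u = n"
    and a_eq: "a = select_vec n \<kappa> (snd (lti_step (perm_alg n m (A, B, C, D)) (x @\<^sub>v w) u)) u"
    using conj_alg_input_exists[OF Rp det_conj_input_perm_alg xw a] by blast
  define u1 where "u1 = select_vec n {..<m} w u"
  define x1 where "x1 = A *\<^sub>v x + B *\<^sub>v u1"
  define y1 where "y1 = C *\<^sub>v x + D *\<^sub>v u1"
  define y2 where "y2 = C *\<^sub>v x1 + D *\<^sub>v (F *\<^sub>v u)"
  have [simp]: "dim_vec u1 = n" "dim_vec x1 = s" "dim_vec y1 = n" "dim_vec y2 = n"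
    by (simp_all add: u1_def x1_def y1_def y2_def)
  have step1: "lti_step (A, B, C, D) x u1 = (x1, y1)" by (simp add: lti_step_def x1_def y1_def)
  have perm_step: "lti_step (perm_alg n m (A, B, C, D)) (x @\<^sub>v w) u = (x1 @\<^sub>v F *\<^sub>v u, select_vec n {..<m} y2 y1)"
    using x w u step1 by (intro lti_step_perm_alg[OF dims]) (auto simp: lti_step_def u1_def y2_def)
  have lhs: "lti_step (conj_alg n \<kappa> (perm_alg n m (A, B, C, D))) (x @\<^sub>v w) a
      = (x1 @\<^sub>v F *\<^sub>v u, select_vec n \<kappa> u (select_vec n {..<m} y2 y1))"
    using lti_step_conj_alg[OF Rp det_conj_input_perm_alg xw u perm_step] a_eq perm_step by simp
  have a_i: "a $ i = (if i \<in> \<kappa> then if i < m then y2 $ i else y1 $ i else u $ i)" if "i < n" for i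
    using that by (subst a_eq) (simp add: perm_step)
  have D_u1: "(D *\<^sub>v u1) $ i = (D *\<^sub>v (F *\<^sub>v w)) $ i" if "i < m" for i
  proof -
    have "F *\<^sub>v u1 = F *\<^sub>v w" using w by (auto simp: u1_def intro!: eq_vecI)
    then show ?thesis using D_prefix[OF that, of u1] by simp
  qed
  define w' where "w' = F *\<^sub>v select_vec n \<kappa> (C *\<^sub>v x + D *\<^sub>v (F *\<^sub>v w)) (F *\<^sub>v w)"
  have "select_vec n {..<m} w' a = select_vec n \<kappa> y1 u1"
    using x w m_le_n D_u1 a_i by (auto simp: w'_def y1_def u1_def intro!: eq_vecI)
  then have conj_step1: "lti_step (conj_alg n \<kappa> (A, B, C, D)) x (select_vec n {..<m} w' a) = (x1, select_vec n \<kappa> u1 y1)"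
    by (intro lti_step_conj_alg[OF dims det_conj_input x _ step1]) simp_all
  define y3 where "y3 = snd (lti_step (conj_alg n \<kappa> (A, B, C, D)) x1 (F *\<^sub>v a))"
  have y3: "F *\<^sub>v y3 = F *\<^sub>v select_vec n \<kappa> u y2"
    unfolding y3_def y2_def using u a m_le_n a_i by (intro F_mult_conj_alg_output) (auto simp: y2_def)
  have rhs: "lti_step (perm_alg n m (conj_alg n \<kappa> (A, B, C, D))) (x @\<^sub>v w') a
      = (x1 @\<^sub>v F *\<^sub>v a, select_vec n {..<m} y3 (select_vec n \<kappa> u1 y1))"
    using Rc x a conj_step1 by (intro lti_step_perm_alg) (simp_all add: w'_def y3_def)
  have S_next: "S *\<^sub>v (x1 @\<^sub>v F *\<^sub>v u) = x1 @\<^sub>v F *\<^sub>v a"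
    using u a m_le_n a_i by (auto simp: S_mult_vec y2_def intro!: eq_vecI)
  have "y3 $ i = select_vec n \<kappa> u y2 $ i" if "i < m" for i
    using that m_le_n u dim_lti_step(2)[OF Rc] arg_cong[OF y3, of "\<lambda>v. v $ i"] by (simp add: y3_def)
  then have outputs_eq: "select_vec n {..<m} y3 (select_vec n \<kappa> u1 y1)
      = select_vec n \<kappa> u (select_vec n {..<m} y2 y1)"
    using u w by (auto simp: u1_def intro!: eq_vecI)
  show ?thesis unfolding \<open>v = x @\<^sub>v w\<close> using lhs rhs S_next outputs_eq by (simp add: S_mult_vec[OF x w, folded w'_def])
qed

end

theorem propositionG1:
  fixes n m :: nat and \<kappa> :: "nat set" and R :: lti
  assumes "lti_wf n R"
    and "causal n R"
    and "\<kappa> \<subseteq> {..<n}"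
    and "invertible_mat (Dblock R \<kappa>)"
    and "m < n"
  shows "same_transfer (conj_alg n \<kappa> (perm_alg n m R)) (perm_alg n m (conj_alg n \<kappa> R))"
proof -
  obtain A B C D where R: "R = (A, B, C, D)" by (cases R)
  from assms(1) obtain s where R_dims: "lti_dims s n R" by (auto simp: lti_wf_def lti_dims_def R)
  then have D: "D \<in> carrier_mat n n" by (simp add: lti_dims_def R)
  have lower: "lower_triangular_mat D" using assms(2) D by (auto simp: causal_def lower_triangular_mat_def R)
  have "D $$ (i, i) \<noteq> 0" if "i \<in> \<kappa>" for i
    using lower_triangular_diag_neq_0_if_invertible_block[OF D lower assms(3) _ that] assms(4)
    by (simp add: Dblock_def R)
  then interpret causal_lti n s m \<kappa> A B C D
    using R_dims lower assms(5) by unfold_locales (simp_all add: R)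
  show ?thesis unfolding R
    by (rule same_transfer_if_simulation[OF lti_dims_conj_alg[OF lti_dims_perm_alg[OF R_dims[unfolded R]] det_conj_input_perm_alg]
          lti_dims_perm_alg[OF lti_dims_conj_alg[OF R_dims[unfolded R] det_conj_input]] S_carrier conj_perm_simulation])
qed

end
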